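(* Let $\mathbf{A}\in\mathbb{R}^{m\times n}$ have full row rank, $\mathbf{b}\in\mathbb{R}^m$, $\mathbf{c}\in\mathbb{R}^n$, and let $(\mathbf{x},\mathbf{y})$ be a primal-dual optimal solution of the LP $\min\{\mathbf{c}^\top\mathbf{x}:\mathbf{A}\mathbf{x}=\mathbf{b},\ \mathbf{x}\ge\mathbf{0}\}$. Consider the randomized crossover algorithm described in the context, started from $(\mathbf{x},\mathbf{y})$. With probability $1$, the algorithm terminates and outputs a primal-dual optimal vertex solution after at most $n$ primal and/or dual push steps in total. Consequently, it requires solving at most $n$ ordinary least squares (OLS) subproblems.
   Context: The dual LP is $\max\{\mathbf{b}^\top\mathbf{y}:\mathbf{A}^\top\mathbf{y}\le\mathbf{c}\}$; a pair is primal-dual optimal if its components are optimal for the primal and the dual respectively. $\mathbf{A}_i$ is the $i$-th column of $\mathbf{A}$; for an index set $J$, $\mathbf{A}_J$ is the submatrix of columns indexed by $J$ and $\mathbf{x}_J$ the corresponding subvector; $^\dagger$ is the Moore–Penrose inverse. All computations are exact. A primal-dual optimal vertex solution with basis $(B,N)$ is a pair $(\mathbf{x},\mathbf{y})$ with a partition $(B,N)$ of $\{1,\dots,n\}$ such that $|B|=m$, $\mathbf{A}_B$ is nonsingular, $\mathbf{x}_B=\mathbf{A}_B^{-1}\mathbf{b}\ge\mathbf{0}$, $\mathbf{x}_N=\mathbf{0}$, $\mathbf{y}=(\mathbf{A}_B^\top)^{-1}\mathbf{c}_B$, and $\mathbf{c}_N-\mathbf{A}_N^\top\mathbf{y}\ge\mathbf{0}$.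 Crossover algorithm (input: primal-dual optimal $(\mathbf{x},\mathbf{y})$). 1. Primal push. Set $B=\{i:\mathbf{x}_i>0\}$. While the primal support can be further reduced (i.e. while the columns of $\mathbf{A}_B$ are linearly dependent), perform a primal push step: draw a fresh random cost $\tilde{\mathbf{c}}_B=\frac{1}{\|\mathbf{c}_B\|_\infty+1}\mathbf{c}_B+\boldsymbol{\delta}_{\mathbf{c}}$, where the entries of $\boldsymbol{\delta}_{\mathbf{c}}$ are independent and uniform on $[0,1]$; solve the OLS subproblem $\min_{\mathbf{y}'}\frac12\|\mathbf{A}_B^\top\mathbf{y}'-\tilde{\mathbf{c}}_B\|_2^2$ to obtain the direction $(\boldsymbol{\delta}_{\mathbf{x}})_B=-[\tilde{\mathbf{c}}_B-\mathbf{A}_B^\top(\mathbf{A}_B\mathbf{A}_B^\top)^\dagger\mathbf{A}_B\tilde{\mathbf{c}}_B]$. If $(\boldsymbol{\delta}_{\mathbf{x}})_B\ne\mathbf{0}$: if $(\boldsymbol{\delta}_{\mathbf{x}})_B\ge\mathbf{0}$, replace it by $-(\boldsymbol{\delta}_{\mathbf{x}})_B$; set $\theta=\min\{-\mathbf{x}_i/(\boldsymbol{\delta}_{\mathbf{x}})_i: i\in B,\ (\boldsymbol{\delta}_{\mathbf{x}})_i<0\}$; update $\mathbf{x}_B\leftarrow\mathbf{x}_B+\theta(\boldsymbol{\delta}_{\mathbf{x}})_B$ and $B\leftarrow B\setminus\{i\in B:\mathbf{x}_i=0\}$. 2. Dual push. Set $D=\{i:\mathbf{c}_i-\mathbf{A}_i^\top\mathbf{y}=0\}$,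 $N=\{i:\mathbf{c}_i-\mathbf{A}_i^\top\mathbf{y}>0\}$. While dual constraints can be further activated (i.e. while the rows of $\mathbf{A}_D$ are linearly dependent), perform a dual push step: draw a fresh random right-hand side $\tilde{\mathbf{b}}=\frac{1}{\|\mathbf{b}\|_\infty+1}\mathbf{b}+\boldsymbol{\delta}_{\mathbf{b}}$, where the entries of $\boldsymbol{\delta}_{\mathbf{b}}$ are independent and uniform on $[0,1]$; solve the OLS subproblem $\min_{\mathbf{x}'_D}\frac12\|\mathbf{A}_D\mathbf{x}'_D-\tilde{\mathbf{b}}\|_2^2$ to obtain the direction $\boldsymbol{\delta}_{\mathbf{y}}=\tilde{\mathbf{b}}-\mathbf{A}_D(\mathbf{A}_D^\top\mathbf{A}_D)^\dagger\mathbf{A}_D^\top\tilde{\mathbf{b}}$. If $\mathbf{A}_N^\top\boldsymbol{\delta}_{\mathbf{y}}\ne\mathbf{0}$: if $\mathbf{A}_N^\top\boldsymbol{\delta}_{\mathbf{y}}\le\mathbf{0}$, replace $\boldsymbol{\delta}_{\mathbf{y}}$ by $-\boldsymbol{\delta}_{\mathbf{y}}$; set $\theta=\min\{(\mathbf{c}_i-\mathbf{A}_i^\top\mathbf{y})/(\mathbf{A}_i^\top\boldsymbol{\delta}_{\mathbf{y}}): i\in N,\ \mathbf{A}_i^\top\boldsymbol{\delta}_{\mathbf{y}}>0\}$; update $\mathbf{y}\leftarrow\mathbf{y}+\theta\boldsymbol{\delta}_{\mathbf{y}}$, and move all $i\in N$ with $\mathbf{c}_i-\mathbf{A}_i^\top\mathbf{y}=0$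 from $N$ to $D$. 3. Linear independence check. Select (via LU decomposition) a set $C\subseteq D\setminus B$ of $m-|B|$ indices such that the columns of $\mathbf{A}_{B\cup C}$ are linearly independent; set $B\leftarrow B\cup C$ and $N\leftarrow\{1,\dots,n\}\setminus B$. Output $(\mathbf{x},\mathbf{y})$ and $(B,N)$. Each primal or dual push step (one loop iteration) solves exactly one OLS subproblem. The random draws in different steps are independent. *)

theory Defs
  imports "HOL-Probability.Probability" "HOL-Library.While_Combinator"
begin

subsection \<open>The linear program and its dual\<close>

text \<open>Primal: minimise \<open>c \<bullet> x\<close> subject to \<open>A x = b\<close>, \<open>x \<ge> 0\<close>.
  Dual: maximise \<open>b \<bullet> y\<close> subject to \<open>A\<^sup>T y \<le> c\<close>.\<close>

definition primal_feasible :: "real^'n^'m \<Rightarrow> real^'m \<Rightarrow> real^'n \<Rightarrow> bool" where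
  "primal_feasible A b x \<longleftrightarrow> A *v x = b \<and> (\<forall>i. 0 \<le> x $ i)"

definition primal_optimal :: "real^'n^'m \<Rightarrow> real^'m \<Rightarrow> real^'n \<Rightarrow> real^'n \<Rightarrow> bool" where
  "primal_optimal A b c x \<longleftrightarrow>
     primal_feasible A b x \<and> (\<forall>x'. primal_feasible A b x' \<longrightarrow> c \<bullet> x \<le> c \<bullet> x')"

definition dual_feasible :: "real^'n^'m \<Rightarrow> real^'n \<Rightarrow> real^'m \<Rightarrow> bool" where
  "dual_feasible A c y \<longleftrightarrow> (\<forall>i. (transpose A *v y) $ i \<le> c $ i)"

definition dual_optimal :: "real^'n^'m \<Rightarrow> real^'m \<Rightarrow> real^'n \<Rightarrow> real^'m \<Rightarrow> bool" where
  "dual_optimal A b c y \<longleftrightarrow>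
     dual_feasible A c y \<and> (\<forall>y'. dual_feasible A c y' \<longrightarrow> b \<bullet> y' \<le> b \<bullet> y)"

definition primal_dual_optimal ::
    "real^'n^'m \<Rightarrow> real^'m \<Rightarrow> real^'n \<Rightarrow> real^'n \<Rightarrow> real^'m \<Rightarrow> bool" where
  "primal_dual_optimal A b c x y \<longleftrightarrow> primal_optimal A b c x \<and> dual_optimal A b c y"

text \<open>An enumeration \<open>\<beta>\<close> of an index set \<open>B\<close> with \<open>CARD('m)\<close> elements turns \<open>A\<^sub>B\<close> into a genuine
  square matrix and \<open>x\<^sub>B\<close>, \<open>c\<^sub>B\<close> into vectors over \<open>'m\<close>. The conditions below do not depend on
  which enumeration is chosen.\<close>

definition basis_matrix :: "real^'n^'m \<Rightarrow> ('m \<Rightarrow> 'n) \<Rightarrow> real^'m^'m" where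
  "basis_matrix A \<beta> = (\<chi> i j. A $ i $ \<beta> j)"

definition optimal_vertex_with_basis ::
    "real^'n^'m \<Rightarrow> real^'m \<Rightarrow> real^'n \<Rightarrow> real^'n \<Rightarrow> real^'m \<Rightarrow> 'n set \<Rightarrow> 'n set \<Rightarrow> bool" where
  "optimal_vertex_with_basis A b c x y B N \<longleftrightarrow>
     B \<union> N = UNIV \<and> B \<inter> N = {} \<and> card B = CARD('m) \<and>
     (\<exists>\<beta>. bij_betw \<beta> UNIV B \<and>
        invertible (basis_matrix A \<beta>) \<and>
        (\<chi> j. x $ \<beta> j) = matrix_inv (basis_matrix A \<beta>) *v b \<and>
        y = matrix_inv (transpose (basis_matrix A \<beta>)) *v (\<chi> j. c $ \<beta> j)) \<and>
     (\<forall>i\<in>B. 0 \<le> x $ i) \<and> (\<forall>i\<in>N. x $ i = 0) \<and>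
     (\<forall>i\<in>N. 0 \<le> c $ i - (transpose A *v y) $ i)"


subsection \<open>Submatrices, linear independence, least squares\<close>

text \<open>For an index set \<open>J\<close>, the submatrix \<open>A\<^sub>J\<close> and the subvector \<open>x\<^sub>J\<close> are represented by zero
  padding outside \<open>J\<close>, i.e. \<open>\<real>\<^sup>J\<close> is identified with the coordinate subspace of \<open>\<real>\<^sup>n\<close> of vectors
  supported on \<open>J\<close>. Transposes, products, linear (in)dependence of rows, Moore--Penrose inverses
  and the maximum norm of a subvector with \<open>J\<close> nonempty all commute with this padding:
  \<open>A\<^sub>J A\<^sub>J\<^sup>T\<close> is literally the same matrix, \<open>A\<^sub>J\<^sup>T A\<^sub>J\<close> and its pseudo-inverse acquire zero rows
  and columns outside \<open>J\<close>.\<close>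

definition cols :: "real^'n^'m \<Rightarrow> 'n set \<Rightarrow> real^'n^'m" where
  "cols A J = (\<chi> i j. if j \<in> J then A $ i $ j else 0)"

definition subvec :: "real^'n \<Rightarrow> 'n set \<Rightarrow> real^'n" where
  "subvec v J = (\<chi> j. if j \<in> J then v $ j else 0)"

text \<open>Injectivity is needed because rows and columns are indexed families: two equal columns are
  linearly dependent, although the set containing them may be independent.\<close>

definition indep_family :: "('i \<Rightarrow> 'v::real_vector) \<Rightarrow> 'i set \<Rightarrow> bool" where
  "indep_family v J \<longleftrightarrow> inj_on v J \<and> independent (v ` J)"

definition cols_independent :: "real^'n^'m \<Rightarrow> 'n set \<Rightarrow> bool" where
  "cols_independent A J \<longleftrightarrow> indep_family (\<lambda>j. column j A) J"

definition rows_independent :: "real^'n^'m \<Rightarrow> bool" where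
  "rows_independent A \<longleftrightarrow> indep_family (\<lambda>i. row i A) UNIV"

text \<open>The Moore--Penrose inverse, characterised by the four Penrose equations, which have exactly
  one solution for every real matrix.\<close>

definition is_pinv :: "real^'n^'m \<Rightarrow> real^'m^'n \<Rightarrow> bool" where
  "is_pinv A X \<longleftrightarrow>
     A ** X ** A = A \<and> X ** A ** X = X \<and>
     transpose (A ** X) = A ** X \<and> transpose (X ** A) = X ** A"

definition pinv :: "real^'n^'m \<Rightarrow> real^'m^'n" where
  "pinv A = (THE X. is_pinv A X)"

text \<open>A pair \<open>(Q, d)\<close> stands for the ordinary least squares problem of minimising
  \<open>\<parallel>Q z - d\<parallel>\<^sup>2 / 2\<close> over \<open>z\<close>.\<close>

type_synonym ('r, 's) ols = "(real^'s^'r) \<times> (real^'r)"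

fun ols_solution :: "('r::finite, 's::finite) ols \<Rightarrow> real^'s" where
  "ols_solution (Q, d) = pinv (transpose Q ** Q) *v (transpose Q *v d)"

fun ols_residual :: "('r::finite, 's::finite) ols \<Rightarrow> real^'r" where
  "ols_residual (Q, d) = d - Q *v ols_solution (Q, d)"


subsection \<open>The crossover algorithm for a fixed realisation of the random draws\<close>

text \<open>\<open>\<delta>c k\<close> and \<open>\<delta>b k\<close> are the draws used in the \<open>k\<close>-th primal and in the \<open>k\<close>-th dual push
  step. A primal push step uses only the entries of \<open>\<delta>c k\<close> in the current set \<open>B\<close>.
  The states also count the loop iterations (\<open>psteps\<close>, \<open>dsteps\<close>) and log the least squares
  problems that have been solved (\<open>pols\<close>, \<open>dols\<close>). An iteration with a zero direction counts as a
  step, although it changes neither the solution nor the index sets.\<close>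

record ('m::finite, 'n::finite) primal_state =
  psteps :: nat
  pols :: "('n, 'm) ols list"
  pB :: "'n set"
  px :: "real^'n"

definition perturbed_cost :: "real^'n \<Rightarrow> real^'n \<Rightarrow> 'n set \<Rightarrow> real^'n" where
  "perturbed_cost c \<delta> B =
     (1 / (infnorm (subvec c B) + 1)) *\<^sub>R subvec c B + subvec \<delta> B"

definition primal_push_step ::
    "real^'n^'m \<Rightarrow> real^'n \<Rightarrow> (nat \<Rightarrow> real^'n) \<Rightarrow>
     ('m::finite, 'n::finite) primal_state \<Rightarrow> ('m, 'n) primal_state" where
  "primal_push_step A c \<delta>c s =
    (let B = pB s; x = px s;
         P = (transpose (cols A B), perturbed_cost c (\<delta>c (psteps s)) B);
         \<delta>0 = - ols_residual P;
         \<delta> = (if \<forall>i\<in>B. 0 \<le> \<delta>0 $ i then - \<delta>0 else \<delta>0);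
         \<theta> = Min {- (x $ i) / (\<delta> $ i) | i. i \<in> B \<and> \<delta> $ i < 0};
         x' = (if \<delta>0 = 0 then x else x + \<theta> *\<^sub>R \<delta>);
         B' = (if \<delta>0 = 0 then B else B - {i \<in> B. x' $ i = 0})
     in \<lparr>psteps = Suc (psteps s), pols = pols s @ [P], pB = B', px = x'\<rparr>)"

definition primal_push ::
    "real^'n^'m \<Rightarrow> real^'n \<Rightarrow> (nat \<Rightarrow> real^'n) \<Rightarrow> real^'n \<Rightarrow>
     ('m::finite, 'n::finite) primal_state option" where
  "primal_push A c \<delta>c x =
     while_option (\<lambda>s. \<not> cols_independent A (pB s)) (primal_push_step A c \<delta>c)
       \<lparr>psteps = 0, pols = [], pB = {i. 0 < x $ i}, px = x\<rparr>"

record ('m::finite, 'n::finite) dual_state =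
  dsteps :: nat
  dols :: "('m, 'n) ols list"
  dD :: "'n set"
  dN :: "'n set"
  dy :: "real^'m"

definition slack :: "real^'n^'m \<Rightarrow> real^'n \<Rightarrow> real^'m \<Rightarrow> real^'n" where
  "slack A c y = c - transpose A *v y"

definition perturbed_rhs :: "real^'m \<Rightarrow> real^'m \<Rightarrow> real^'m" where
  "perturbed_rhs b \<delta> = (1 / (infnorm b + 1)) *\<^sub>R b + \<delta>"

definition dual_push_step ::
    "real^'n^'m \<Rightarrow> real^'m \<Rightarrow> real^'n \<Rightarrow> (nat \<Rightarrow> real^'m) \<Rightarrow>
     ('m::finite, 'n::finite) dual_state \<Rightarrow> ('m, 'n) dual_state" where
  "dual_push_step A b c \<delta>b s =
    (let D = dD s; N = dN s; y = dy s;
         P = (cols A D, perturbed_rhs b (\<delta>b (dsteps s)));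
         \<delta>0 = ols_residual P;
         skip = (\<forall>i\<in>N. (transpose A *v \<delta>0) $ i = 0);
         \<delta> = (if \<forall>i\<in>N. (transpose A *v \<delta>0) $ i \<le> 0 then - \<delta>0 else \<delta>0);
         g = transpose A *v \<delta>;
         \<theta> = Min {slack A c y $ i / g $ i | i. i \<in> N \<and> 0 < g $ i};
         y' = (if skip then y else y + \<theta> *\<^sub>R \<delta>);
         Z = (if skip then {} else {i \<in> N. slack A c y' $ i = 0})
     in \<lparr>dsteps = Suc (dsteps s), dols = dols s @ [P], dD = D \<union> Z, dN = N - Z, dy = y'\<rparr>)"

definition dual_push ::
    "real^'n^'m \<Rightarrow> real^'m \<Rightarrow> real^'n \<Rightarrow> (nat \<Rightarrow> real^'m) \<Rightarrow> real^'m \<Rightarrow>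
     ('m::finite, 'n::finite) dual_state option" where
  "dual_push A b c \<delta>b y =
     while_option (\<lambda>s. \<not> rows_independent (cols A (dD s))) (dual_push_step A b c \<delta>b)
       \<lparr>dsteps = 0, dols = [], dD = {i. slack A c y $ i = 0}, dN = {i. 0 < slack A c y $ i},
        dy = y\<rparr>"

text \<open>\<open>crossover A b c \<delta>c \<delta>b x y k q x' y' B N\<close>: started from \<open>(x, y)\<close>, the algorithm can
  terminate after \<open>k\<close> push steps in total, having solved \<open>q\<close> least squares problems, with output
  \<open>(x', y')\<close> and \<open>(B, N)\<close>. It is a relation because any admissible selection \<open>C\<close> is allowed in
  the linear independence check; the two loops are deterministic once the draws are fixed.\<close>

definition crossover ::
    "real^'n^'m \<Rightarrow> real^'m \<Rightarrow> real^'n \<Rightarrow> (nat \<Rightarrow> real^'n) \<Rightarrow> (nat \<Rightarrow> real^'m) \<Rightarrow>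
     real^'n \<Rightarrow> real^'m \<Rightarrow> nat \<Rightarrow> nat \<Rightarrow> real^'n \<Rightarrow> real^'m \<Rightarrow> 'n set \<Rightarrow> 'n set \<Rightarrow> bool" where
  "crossover A b c \<delta>c \<delta>b x y k q x' y' B N \<longleftrightarrow>
     (\<exists>s t C.
        primal_push A c \<delta>c x = Some s \<and> dual_push A b c \<delta>b y = Some t \<and>
        C \<subseteq> dD t - pB s \<and> card C = CARD('m) - card (pB s) \<and>
        cols_independent A (pB s \<union> C) \<and>
        x' = px s \<and> y' = dy t \<and> B = pB s \<union> C \<and> N = UNIV - B \<and>
        k = psteps s + dsteps t \<and> q = length (pols s) + length (dols t))"


subsection \<open>The random draws\<close>

definition independent_uniform_draws ::
    "'w measure \<Rightarrow> (nat \<Rightarrow> 'w \<Rightarrow> real^'n) \<Rightarrow> (nat \<Rightarrow> 'w \<Rightarrow> real^'m) \<Rightarrow> bool" where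
  "independent_uniform_draws M \<delta>c \<delta>b \<longleftrightarrow>
     prob_space.indep_vars M (\<lambda>_. borel)
       (case_sum (\<lambda>(k, i) \<omega>. \<delta>c k \<omega> $ i) (\<lambda>(k, j) \<omega>. \<delta>b k \<omega> $ j)) UNIV \<and>
     (\<forall>k i. distr M borel (\<lambda>\<omega>. \<delta>c k \<omega> $ i) = uniform_measure lborel {0..1}) \<and>
     (\<forall>k j. distr M borel (\<lambda>\<omega>. \<delta>b k \<omega> $ j) = uniform_measure lborel {0..1})"

end

theory Submission
  imports Defs
begin

text \<open>Almost surely every draw is generic: for every column set \<open>B\<close> with dependent columns, the perturbed
  cost is not orthogonal to some fixed nonzero \<open>v \<in> ker A\<^sub>B\<close>, since \<open>v \<bullet> \<delta>\<close> has an atomless law; dually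
  for the right-hand side. Only finitely many sets and countably many draws are involved, so the
  null sets can be removed in advance and the dependence of the current set on earlier draws is
  irrelevant. For generic draws the least squares residual, which is the push direction, is
  nonzero, and each ratio test removes an index from the primal support or from the set of
  inactive dual constraints. Strong duality makes these two sets disjoint at the start, so their
  sizes, which bound the two step counts, add up to at most \<open>n\<close>. It also puts the primal support
  inside the active set, whose columns span the whole space after the dual push; hence a basis can
  be completed there.\<close>

text \<open>Keeps products in the form \<open>transpose A *v y\<close>, which the definitions use,
  instead of having them rewritten to \<open>y v* A\<close>.\<close>

declare transpose_matrix_vector [simp del]

subsection \<open>Genericity of a random draw\<close>

text \<open>Independence splits the \<open>j\<close>-th summand off from the remaining sum
  \<open>S\<close>. For each value of \<open>S\<close> only one value of that summand makes the
  expression vanish, and this value has probability zero; Fubini's theorem combines the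
  slices.\<close>

lemma (in prob_space) AE_affine_comb_neq_zero:
  fixes X :: "'i \<Rightarrow> 'a \<Rightarrow> real"
  assumes ind: "indep_vars (\<lambda>_. borel) X I" and J: "finite J" "J \<subseteq> I"
    and j: "j \<in> J" "v j \<noteq> 0"
    and atomless: "\<And>a. emeasure (distr M borel (X j)) {a} = 0"
  shows "AE \<omega> in M. a + (\<Sum>i\<in>J. v i * X i \<omega>) \<noteq> 0"
proof -
  define Y where "Y i \<omega> = v i * X i \<omega>" for i \<omega>
  define S where "S \<omega> = (\<Sum>i\<in>J - {j}. Y i \<omega>)" for \<omega>
  have "indep_vars (\<lambda>_. borel) X (insert j (J - {j}))"
    by (rule indep_vars_subset[OF ind]) (use J j in auto)
  then have "indep_vars (\<lambda>_. borel) Y (insert j (J - {j}))"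
    unfolding Y_def by (rule indep_vars_compose2) simp
  then have "indep_var borel (Y j) borel S"
    unfolding S_def using J by (intro indep_vars_sum) auto
  then have rv [measurable]: "random_variable borel (Y j)" "random_variable borel S"
    and eq: "distr M borel (Y j) \<Otimes>\<^sub>M distr M borel S = distr M (borel \<Otimes>\<^sub>M borel) (\<lambda>\<omega>. (Y j \<omega>, S \<omega>))"
    by (auto simp: indep_var_distribution_eq)
  have X [measurable]: "random_variable borel (X j)"
    using ind J j by (auto simp: indep_vars_def2)
  interpret PY: prob_space "distr M borel (Y j)" by (rule prob_space_distr) simp
  interpret PS: prob_space "distr M borel S" by (rule prob_space_distr) simp
  have Y_null: "emeasure (distr M borel (Y j)) {r} = 0" for r
  proof -
    have "Y j -` {r} \<inter> space M = X j -` {r / v j} \<inter> space M"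
      using j by (auto simp: Y_def field_simps)
    then show ?thesis
      using atomless[of "r / v j"] by (simp add: emeasure_distr)
  qed
  define Z where "Z = {p :: real \<times> real. a + fst p + snd p = 0}"
  have Z [measurable]: "Z \<in> sets (borel \<Otimes>\<^sub>M borel)"
  proof -
    have "closed Z"
      unfolding Z_def by (intro closed_Collect_eq continuous_intros)
    then show ?thesis using borel_closed[of Z] by (simp only: borel_prod)
  qed
  have sl: "(\<lambda>x. (x, s)) -` Z = {- a - s}" for s
    by (auto simp: Z_def)
  interpret PP: pair_sigma_finite "distr M borel (Y j)" "distr M borel S" ..
  have "emeasure (distr M borel (Y j) \<Otimes>\<^sub>M distr M borel S) Z = 0"
    by (subst PP.emeasure_pair_measure_alt2) (simp_all add: sl Y_null)
  then have "emeasure M ((\<lambda>\<omega>. (Y j \<omega>, S \<omega>)) -` Z \<inter> space M) = 0"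
    unfolding eq by (simp add: emeasure_distr)
  then have "AE \<omega> in M. \<omega> \<notin> (\<lambda>\<omega>. (Y j \<omega>, S \<omega>)) -` Z \<inter> space M"
    by (intro AE_not_in null_setsI) measurable
  with AE_space have "AE \<omega> in M. a + Y j \<omega> + S \<omega> \<noteq> 0"
    by eventually_elim (simp add: Z_def)
  moreover have "(\<Sum>i\<in>J. v i * X i \<omega>) = Y j \<omega> + S \<omega>" for \<omega>
    unfolding S_def Y_def by (rule sum.remove[OF J(1) j(1)])
  ultimately show ?thesis
    by (simp add: add.assoc)
qed

lemma emeasure_uniform_unit_singleton:
  "emeasure (uniform_measure lborel {0..1::real}) {a} = 0"
  by (simp add: emeasure_uniform_measure emeasure_lborel_countable)

text \<open>One proof serves both kinds of draws: \<open>F\<close> is the joint family of all scalar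
  draws, and the injection \<open>e\<close> selects the primal or the dual ones.\<close>

lemma AE_inner_draw_neq_zero:
  fixes X :: "nat \<Rightarrow> 'w \<Rightarrow> real^'n" and e :: "nat \<times> 'n \<Rightarrow> 'j"
  assumes "prob_space M"
    and "prob_space.indep_vars M (\<lambda>_. borel) F UNIV"
    and F: "\<And>k i. F (e (k, i)) = (\<lambda>\<omega>. X k \<omega> $ i)" and "inj e"
    and unif: "\<And>k i. distr M borel (\<lambda>\<omega>. X k \<omega> $ i) = uniform_measure lborel {0..1}"
    and "v \<noteq> 0"
  shows "AE \<omega> in M. v \<bullet> (w + X k \<omega>) \<noteq> 0"
proof -
  interpret prob_space M by fact
  define p where "p = (\<lambda>i. e (k, i))"
  have "inj p" using \<open>inj e\<close> by (auto simp: p_def inj_def)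
  obtain i where i: "v $ i \<noteq> 0" using \<open>v \<noteq> 0\<close> by (metis vec_eq_iff zero_index)
  \<comment> \<open>\<open>u\<close> moves the coefficients of \<open>v\<close> from coordinates to
    the matching indices of the joint family.\<close>
  define u where "u = (\<lambda>j. v $ inv p j)"
  have "AE \<omega> in M. v \<bullet> w + (\<Sum>j\<in>range p. u j * F j \<omega>) \<noteq> 0"
  proof (rule AE_affine_comb_neq_zero[where j = "p i"])
    show "u (p i) \<noteq> 0" using i \<open>inj p\<close> by (simp add: u_def)
    show "emeasure (distr M borel (F (p i))) {a} = 0" for a
      by (simp add: p_def F unif emeasure_uniform_unit_singleton)
  qed (use assms in auto)
  moreover have "(\<Sum>j\<in>range p. u j * F j \<omega>) = v \<bullet> X k \<omega>" for \<omega>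
    using \<open>inj p\<close> by (simp add: sum.reindex u_def inner_vec_def) (simp add: p_def F)
  ultimately show ?thesis
    by (simp add: inner_add_right)
qed

subsection \<open>Complementary slackness\<close>

text \<open>The images under \<open>A\<close> of the nonnegative vectors supported on
  \<open>D\<close> form a convex cone containing these columns, so minimality of the hull
  applies.\<close>

lemma convex_cone_hull_columns:
  fixes A :: "real^'n^'m"
  assumes "b \<in> convex_cone hull ((\<lambda>j. column j A) ` D)"
  obtains z where "A *v z = b" "\<And>i. 0 \<le> z $ i" "\<And>i. i \<notin> D \<Longrightarrow> z $ i = 0"
proof -
  define K where "K = {A *v z | z. (\<forall>i. 0 \<le> z $ i) \<and> (\<forall>i. i \<notin> D \<longrightarrow> z $ i = 0)}"
  have "convex_cone hull ((\<lambda>j. column j A) ` D) \<subseteq> K"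
  proof (rule hull_minimal)
    show "(\<lambda>j. column j A) ` D \<subseteq> K"
    proof safe
      fix j assume "j \<in> D"
      then have "axis j 1 $ i = (0::real)" if "i \<notin> D" for i
        using that by (auto simp: axis_def)
      moreover have "0 \<le> (axis j 1 :: real^'n) $ i" for i
        by (simp add: axis_def)
      ultimately show "column j A \<in> K"
        unfolding K_def using matrix_vector_mult_basis[of A j] by force
    qed
    have "0 \<in> K" unfolding K_def by (intro CollectI exI[of _ 0]) auto
    moreover have "x + y \<in> K" if "x \<in> K" "y \<in> K" for x y
    proof -
      from that obtain z z' where "x = A *v z" "y = A *v z'"
        "\<forall>i. 0 \<le> z $ i" "\<forall>i. i \<notin> D \<longrightarrow> z $ i = 0" "\<forall>i. 0 \<le> z' $ i" "\<forall>i. i \<notin> D \<longrightarrow> z' $ i = 0"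
        unfolding K_def by blast
      then show ?thesis
        unfolding K_def by (intro CollectI exI[of _ "z + z'"]) (auto simp: matrix_vector_right_distrib)
    qed
    moreover have "r *\<^sub>R x \<in> K" if "x \<in> K" "r \<ge> 0" for x r
    proof -
      from that obtain z where "x = A *v z" "\<forall>i. 0 \<le> z $ i" "\<forall>i. i \<notin> D \<longrightarrow> z $ i = 0"
        unfolding K_def by blast
      then show ?thesis
        using that unfolding K_def
        by (intro CollectI exI[of _ "r *\<^sub>R z"]) (auto simp: matrix_vector_mult_scaleR)
    qed
    ultimately show "convex_cone K"
      by (auto simp: convex_cone_iff)
  qed
  with assms that show thesis unfolding K_def by blast
qed

lemma transpose_mult_nth:
  fixes A :: "real^'n^'m"
  shows "(transpose A *v y) $ i = column i A \<bullet> y"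
  by (simp add: matrix_vector_mult_def transpose_def column_def inner_vec_def)

text \<open>A finitely generated cone is closed and convex, so a vector \<open>b\<close> outside it
  could be strictly separated from it; the negated normal of the hyperplane would be a direction
  \<open>d\<close> violating the hypothesis.\<close>

lemma farkas_columns:
  fixes A :: "real^'n^'m"
  assumes "\<And>d. (\<And>i. i \<in> D \<Longrightarrow> (transpose A *v d) $ i \<le> 0) \<Longrightarrow> b \<bullet> d \<le> 0"
  obtains z where "A *v z = b" "\<And>i. 0 \<le> z $ i" "\<And>i. i \<notin> D \<Longrightarrow> z $ i = 0"
proof -
  let ?H = "convex_cone hull ((\<lambda>j. column j A) ` D)"
  have "b \<in> ?H"
  proof (rule ccontr)
    assume "b \<notin> ?H"
    moreover have "closed ?H" "convex ?H"
      by (auto simp: closed_convex_cone_hull convex_convex_cone_hull)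
    ultimately obtain a \<beta> where a: "a \<bullet> b < \<beta>" "\<And>h. h \<in> ?H \<Longrightarrow> \<beta> < a \<bullet> h"
      using separating_hyperplane_closed_point by metis
    have "\<beta> < 0" using a(2)[OF convex_cone_hull_contains_0] by simp
    have "0 \<le> a \<bullet> h" if "h \<in> ?H" for h
    proof (rule ccontr)
      assume neg: "\<not> 0 \<le> a \<bullet> h"
      \<comment> \<open>A negative \<open>a \<bullet> h\<close> could be scaled to equal
        \<open>\<beta>\<close> without leaving the cone, against strict separation.\<close>
      define r where "r = \<beta> / (a \<bullet> h)"
      have "r \<ge> 0" using neg \<open>\<beta> < 0\<close> by (simp add: r_def divide_nonpos_nonpos)
      then have "\<beta> < a \<bullet> (r *\<^sub>R h)"
        using that by (intro a(2) convex_cone_hull_mul)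
      then show False using neg by (simp add: r_def)
    qed
    then have "(transpose A *v (- a)) $ i \<le> 0" if "i \<in> D" for i
      using that by (simp add: transpose_mult_nth inner_commute[of _ a] hull_inc)
    from assms[OF this] a(1) \<open>\<beta> < 0\<close> show False
      by (simp add: inner_commute)
  qed
  then show thesis using that by (rule convex_cone_hull_columns)
qed

lemma inner_transpose_mult:
  fixes A :: "real^'n^'m"
  shows "(A *v x) \<bullet> y = x \<bullet> (transpose A *v y)"
  by (metis dot_lmul_matrix inner_commute transpose_matrix_vector)

lemma slack_nth: "slack A c y $ i = c $ i - (transpose A *v y) $ i"
  by (simp add: slack_def)

lemma dual_feasible_iff_slack: "dual_feasible A c y \<longleftrightarrow> (\<forall>i. 0 \<le> slack A c y $ i)"
  by (simp add: dual_feasible_def slack_nth)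

text \<open>Optimality of \<open>y\<close> excludes directions that improve the dual objective and
  respect the active constraints. Farkas' lemma then gives a primal feasible \<open>z\<close>
  supported on the active set, hence with zero duality gap. As \<open>x\<close> is at least as good
  as \<open>z\<close>, its gap is zero too, and the gap is a sum of nonnegative products.\<close>

lemma complementary_slackness:
  fixes A :: "real^'n^'m"
  assumes "primal_dual_optimal A b c x y" and "0 < x $ i"
  shows "slack A c y $ i = 0"
proof -
  have px: "A *v x = b" "\<And>i. 0 \<le> x $ i"
    and xopt: "\<And>z. A *v z = b \<Longrightarrow> (\<And>i. 0 \<le> z $ i) \<Longrightarrow> c \<bullet> x \<le> c \<bullet> z"
    and dy: "\<And>i. 0 \<le> slack A c y $ i"
    and yopt: "\<And>y'. dual_feasible A c y' \<Longrightarrow> b \<bullet> y' \<le> b \<bullet> y"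
    using assms(1) dual_feasible_iff_slack[of A c y]
    by (auto simp: primal_dual_optimal_def primal_optimal_def primal_feasible_def dual_optimal_def)
  define D where "D = {i. slack A c y $ i = 0}"
  have gap: "c \<bullet> z - b \<bullet> y = (\<Sum>i\<in>UNIV. z $ i * slack A c y $ i)" if "A *v z = b" for z
  proof -
    have "b \<bullet> y = z \<bullet> (transpose A *v y)"
      using that inner_transpose_mult by metis
    then show ?thesis
      by (simp add: inner_vec_def slack_nth algebra_simps sum_subtractf)
  qed
  have "b \<bullet> d \<le> 0" if d: "\<And>i. i \<in> D \<Longrightarrow> (transpose A *v d) $ i \<le> 0" for d
  proof -
    \<comment> \<open>For small positive steps along \<open>d\<close>, constraints active at
      \<open>y\<close> lose no slack, and the others keep positive slack by continuity.\<close>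
    have ev: "eventually (\<lambda>\<epsilon>. 0 \<le> slack A c (y + \<epsilon> *\<^sub>R d) $ i) (at_right 0)" for i
    proof (cases "i \<in> D")
      case True
      have "eventually (\<lambda>\<epsilon>::real. \<epsilon> > 0) (at_right 0)"
        by (simp add: eventually_at_right_less)
      then show ?thesis
      proof eventually_elim
        case (elim \<epsilon>)
        then have "\<epsilon> * (transpose A *v d) $ i \<le> 0"
          using d[OF True] by (simp add: mult_nonneg_nonpos)
        then show ?case
          using dy[of i] by (simp add: slack_nth matrix_vector_right_distrib matrix_vector_mult_scaleR)
      qed
    next
      case False
      then have "0 < slack A c y $ i" using dy[of i] by (simp add: D_def)
      moreover have "((\<lambda>\<epsilon>. slack A c (y + \<epsilon> *\<^sub>R d) $ i) \<longlongrightarrow> slack A c y $ i) (at_right 0)"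
        unfolding slack_nth matrix_vector_right_distrib matrix_vector_mult_scaleR
        by (auto intro!: tendsto_eq_intros)
      ultimately have "eventually (\<lambda>\<epsilon>. 0 < slack A c (y + \<epsilon> *\<^sub>R d) $ i) (at_right 0)"
        by (simp add: order_tendstoD(1))
      then show ?thesis by eventually_elim simp
    qed
    have "eventually (\<lambda>\<epsilon>::real. \<epsilon> > 0 \<and> (\<forall>i. 0 \<le> slack A c (y + \<epsilon> *\<^sub>R d) $ i)) (at_right 0)"
      using ev by (intro eventually_conj eventually_at_right_less eventually_all_finite)
    then obtain \<epsilon> :: real where "\<epsilon> > 0" "\<forall>i. 0 \<le> slack A c (y + \<epsilon> *\<^sub>R d) $ i"
      using eventually_happens'[OF trivial_limit_at_right_real] by blast
    then have "b \<bullet> (y + \<epsilon> *\<^sub>R d) \<le> b \<bullet> y"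
      by (intro yopt) (simp add: dual_feasible_iff_slack)
    then show ?thesis
      using \<open>\<epsilon> > 0\<close> by (simp add: inner_add_right mult_le_0_iff)
  qed
  then obtain z where z: "A *v z = b" "\<And>i. 0 \<le> z $ i" "\<And>i. i \<notin> D \<Longrightarrow> z $ i = 0"
    using farkas_columns[of D A b] by blast
  have "(\<Sum>i\<in>UNIV. z $ i * slack A c y $ i) = 0"
    using z(3) by (intro sum.neutral) (auto simp: D_def)
  then have "(\<Sum>i\<in>UNIV. x $ i * slack A c y $ i) \<le> 0"
    using gap[OF z(1)] gap[OF px(1)] xopt[OF z(1,2)] by simp
  moreover have "0 \<le> x $ i * slack A c y $ i" for i
    using px(2) dy by simp
  ultimately have "(\<Sum>i\<in>UNIV. x $ i * slack A c y $ i) = 0"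
    by (intro antisym sum_nonneg) auto
  then have "x $ i * slack A c y $ i = 0"
    using \<open>\<And>i. 0 \<le> x $ i * slack A c y $ i\<close> by (subst (asm) sum_nonneg_eq_0_iff) auto
  then show ?thesis using assms(2) by simp
qed

subsection \<open>Least squares residuals\<close>

lemma matrix_add_mult_distrib:
  fixes A B :: "real^'n^'m" and C :: "real^'k^'n"
  shows "(A + B) ** C = A ** C + B ** C"
  by (simp add: matrix_eq algebra_simps flip: matrix_vector_mul_assoc)

lemma matrix_diff_mult_distrib:
  fixes A B :: "real^'n^'m" and C :: "real^'k^'n"
  shows "(A - B) ** C = A ** C - B ** C"
  by (simp add: matrix_eq algebra_simps flip: matrix_vector_mul_assoc)

lemma matrix_mult_diff_distrib:
  fixes A :: "real^'n^'m" and B C :: "real^'k^'n"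
  shows "A ** (B - C) = A ** B - A ** C"
  by (simp add: matrix_eq algebra_simps flip: matrix_vector_mul_assoc)

text \<open>By the Penrose equations \<open>A ** X\<close> and \<open>A ** Y\<close> are the same
  orthogonal projection, and so are \<open>X ** A\<close> and \<open>Y ** A\<close>; these products
  determine \<open>X = X ** A ** X\<close>.\<close>

lemma is_pinv_unique:
  fixes A :: "real^'n^'m"
  assumes X: "is_pinv A X" and Y: "is_pinv A Y"
  shows "X = Y"
proof -
  have "A ** X = transpose (A ** Y ** A ** X)"
    using X Y by (simp add: is_pinv_def)
  also have "\<dots> = transpose (A ** X) ** transpose (A ** Y)"
    by (simp add: matrix_transpose_mul matrix_mul_assoc)
  also have "\<dots> = A ** Y"
    using X Y by (simp add: is_pinv_def matrix_mul_assoc)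
  finally have AX: "A ** X = A ** Y" .
  have "X ** A = transpose (X ** (A ** Y ** A))"
    using X Y by (simp add: is_pinv_def)
  also have "\<dots> = transpose (Y ** A) ** transpose (X ** A)"
    by (simp add: matrix_transpose_mul matrix_mul_assoc)
  also have "\<dots> = Y ** A ** X ** A"
    using X Y by (simp add: is_pinv_def matrix_mul_assoc)
  also have "\<dots> = Y ** (A ** X ** A)"
    by (simp only: matrix_mul_assoc)
  also have "\<dots> = Y ** A"
    using X by (simp add: is_pinv_def)
  finally have XA: "X ** A = Y ** A" .
  have "X = X ** A ** X" using X by (simp add: is_pinv_def)
  also have "\<dots> = Y ** A ** X" by (simp add: XA)
  also have "\<dots> = Y ** (A ** X)" by (simp add: matrix_mul_assoc)
  also have "\<dots> = Y" unfolding AX using Y by (simp add: is_pinv_def matrix_mul_assoc)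
  finally show ?thesis .
qed

text \<open>For an orthonormal basis \<open>E\<close> of \<open>S\<close>, the sum of the rank-one
  matrices formed from each \<open>e\<close> and its transpose has these properties.\<close>

lemma orthogonal_projection_matrix:
  fixes S :: "(real^'n) set"
  assumes "subspace S"
  obtains P :: "real^'n^'n" where "transpose P = P" "\<And>v. P *v v \<in> S"
    "\<And>v. v \<in> S \<Longrightarrow> P *v v = v"
proof -
  obtain E where E: "E \<subseteq> S" "pairwise orthogonal E" "\<And>e. e \<in> E \<Longrightarrow> norm e = 1"
    "independent E" "span E = S"
    by (metis orthonormal_basis_subspace[OF assms])
  have fin: "finite E" using E(4) by (rule independent_imp_finite)
  define P :: "real^'n^'n" where "P = (\<chi> i j. \<Sum>e\<in>E. e $ i * e $ j)"
  have P: "P *v v = (\<Sum>e\<in>E. (v \<bullet> e) *\<^sub>R e)" for v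
    by (simp add: P_def vec_eq_iff matrix_vector_mult_def inner_vec_def sum_distrib_left
        sum_distrib_right mult.assoc sum.swap[of _ UNIV] mult_ac)
  show thesis
  proof
    show "transpose P = P" by (simp add: P_def transpose_def mult.commute)
    show "P *v v \<in> S" for v
      unfolding P using E assms by (intro subspace_sum subspace_scale) auto
    show "P *v v = v" if "v \<in> S" for v
      unfolding P using that E fin by (intro orthonormal_basis_expand) auto
  qed
qed

text \<open>With \<open>P\<close> the orthogonal projection onto the kernel of \<open>G\<close>, the pseudo-inverse is
  \<open>(G + P)\<^sup>-\<^sup>1 - P\<close>.\<close>

lemma is_pinv_symmetric_exists:
  fixes G :: "real^'n^'n"
  assumes sym: "transpose G = G"
  shows "\<exists>X. is_pinv G X"
proof -
  have "subspace {v. G *v v = 0}"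
    by (auto simp: subspace_def matrix_vector_right_distrib matrix_vector_mult_scaleR)
  then obtain P :: "real^'n^'n" where P: "transpose P = P" "\<And>v. G *v (P *v v) = 0"
    "\<And>v. G *v v = 0 \<Longrightarrow> P *v v = v"
    by (rule orthogonal_projection_matrix) auto
  have GP: "G ** P = 0"
    by (simp add: matrix_eq P(2) flip: matrix_vector_mul_assoc)
  have PG: "P ** G = 0"
  proof -
    have "P ** G = transpose (G ** P)"
      by (simp add: matrix_transpose_mul P(1) sym)
    then show ?thesis by (simp add: GP transpose_def vec_eq_iff)
  qed
  have PP: "P ** P = P"
    by (simp add: matrix_eq P flip: matrix_vector_mul_assoc)
  \<comment> \<open>Applying \<open>P\<close> to a kernel vector \<open>v\<close> of
    \<open>G + P\<close> gives \<open>P *v v = 0\<close>. Hence \<open>G *v v = 0\<close>, so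
    \<open>P\<close> fixes \<open>v\<close> and \<open>v = 0\<close>.\<close>
  have "invertible (G + P)"
    unfolding invertible_left_inverse matrix_left_invertible_ker
  proof safe
    fix v assume v: "(G + P) *v v = 0"
    have "P *v v = P *v ((G + P) *v v)"
      by (simp add: matrix_vector_mul_assoc matrix_add_ldistrib PG PP)
    then have "P *v v = 0" by (simp add: v)
    with v have "G *v v = 0" by (simp add: matrix_vector_mult_add_rdistrib)
    then show "v = 0" using P(3) \<open>P *v v = 0\<close> by simp
  qed
  then obtain H where H: "H ** (G + P) = mat 1" "(G + P) ** H = mat 1"
    by (auto simp: invertible_def)
  have "H ** P = H ** ((G + P) ** P)"
    by (simp add: matrix_add_mult_distrib GP PP)
  then have HP: "H ** P = P" by (simp add: matrix_mul_assoc H)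
  have "P ** H = P ** (G + P) ** H"
    by (simp add: matrix_add_ldistrib PG PP)
  then have PH: "P ** H = P" by (simp add: H flip: matrix_mul_assoc)
  have GH: "G ** H = mat 1 - P" and HG: "H ** G = mat 1 - P"
    using H by (simp_all add: matrix_add_ldistrib matrix_add_mult_distrib HP PH eq_diff_eq)
  have GX: "G ** (H - P) = mat 1 - P" and XG: "(H - P) ** G = mat 1 - P"
    by (simp_all add: matrix_diff_mult_distrib matrix_mult_diff_distrib GP PG GH HG)
  have "P $ j $ i = P $ i $ j" for i j
    using arg_cong[OF P(1), of "\<lambda>X. X $ i $ j"] by (simp add: transpose_def)
  then have "transpose (mat 1 - P) = mat 1 - P"
    by (simp add: vec_eq_iff transpose_def mat_def)
  moreover have "(mat 1 - P) ** G = G" and "(mat 1 - P) ** (H - P) = H - P"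
    by (simp_all add: matrix_diff_mult_distrib matrix_mult_diff_distrib PG PH PP)
  ultimately have "is_pinv G (H - P)"
    by (simp add: is_pinv_def GX XG)
  then show ?thesis ..
qed

text \<open>Least squares solutions involve \<open>pinv\<close> only at Gram matrices
  \<open>transpose Q ** Q\<close>, so the symmetric case covers them.\<close>

lemma is_pinv_pinv_symmetric:
  fixes G :: "real^'n^'n"
  assumes "transpose G = G"
  shows "is_pinv G (pinv G)"
proof -
  have "\<exists>!X. is_pinv G X"
    using is_pinv_symmetric_exists[OF assms] is_pinv_unique by blast
  then show ?thesis unfolding pinv_def by (rule theI')
qed

section \<open>Normal equations and nonvanishing residuals\<close>

lemma ols_residual_eq: "ols_residual (Q, d) = d - Q *v ols_solution (Q, d)"
  by simp

declare ols_residual.simps [simp del] ols_solution.simps [simp del]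

text \<open>The orthogonal projection of \<open>d\<close> onto the range of \<open>Q\<close> has the
  form \<open>Q *v z\<close>, and what remains of \<open>d\<close> is orthogonal to that
  range.\<close>

lemma normal_equations_solvable:
  fixes Q :: "real^'s^'r"
  obtains z where "transpose Q *v d = (transpose Q ** Q) *v z"
proof -
  have "subspace (range ((*v) Q))"
    by (intro linear_subspace_image) auto
  then obtain P :: "real^'r^'r" where P: "transpose P = P" "\<And>v. P *v v \<in> range ((*v) Q)"
    "\<And>v. v \<in> range ((*v) Q) \<Longrightarrow> P *v v = v"
    by (rule orthogonal_projection_matrix) auto
  obtain z where z: "P *v d = Q *v z"
    using P(2)[of d] by auto
  have "w \<bullet> (transpose Q *v (d - Q *v z)) = 0" for w
  proof -
    have "w \<bullet> (transpose Q *v (d - Q *v z)) = (Q *v w) \<bullet> (d - P *v d)"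
      by (simp add: inner_transpose_mult z)
    also have "(Q *v w) \<bullet> (P *v d) = (P *v (Q *v w)) \<bullet> d"
      by (simp add: inner_transpose_mult[of P] P(1))
    then have "(Q *v w) \<bullet> (d - P *v d) = 0"
      by (simp add: P(3) inner_diff_right)
    finally show ?thesis .
  qed
  then have "transpose Q *v (d - Q *v z) = 0"
    using inner_eq_zero_iff by blast
  then show thesis
    by (intro that[of z]) (simp add: matrix_vector_mult_diff_distrib matrix_vector_mul_assoc)
qed

text \<open>By the normal equations \<open>transpose Q *v d\<close> lies in the range of the Gram
  matrix \<open>G\<close>, where \<open>G ** pinv G\<close> acts as the identity. This is why pushes
  preserve \<open>A *v x = b\<close> and the active dual constraints.\<close>

lemma transpose_mult_ols_residual:
  fixes Q :: "real^'s^'r"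
  shows "transpose Q *v ols_residual (Q, d) = 0"
proof -
  define G where "G = transpose Q ** Q"
  have "transpose G = G"
    by (simp add: G_def matrix_transpose_mul)
  then have G: "G ** pinv G ** G = G"
    using is_pinv_pinv_symmetric by (auto simp: is_pinv_def)
  obtain z where z: "transpose Q *v d = G *v z"
    unfolding G_def by (rule normal_equations_solvable)
  have QQ: "transpose Q *v (Q *v u) = G *v u" for u
    by (simp add: G_def matrix_vector_mul_assoc)
  have "transpose Q *v ols_residual (Q, d) = G *v z - G *v (pinv G *v (G *v z))"
    by (simp add: ols_residual.simps ols_solution.simps G_def[symmetric] QQ z
        matrix_vector_mult_diff_distrib)
  also have "\<dots> = 0"
    by (simp add: matrix_vector_mul_assoc matrix_mul_assoc G)
  finally show ?thesis .
qed

text \<open>A zero residual would place \<open>d\<close> in the range of \<open>Q\<close>, which is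
  orthogonal to every \<open>v\<close> in the kernel of \<open>transpose Q\<close>.\<close>

lemma ols_residual_neq_zero:
  assumes "transpose Q *v v = 0" and "v \<bullet> d \<noteq> 0"
  shows "ols_residual (Q, d) \<noteq> 0"
proof
  assume "ols_residual (Q, d) = 0"
  then have "v \<bullet> d = v \<bullet> (Q *v ols_solution (Q, d))"
    by (simp add: ols_residual_eq)
  also have "\<dots> = ols_solution (Q, d) \<bullet> (transpose Q *v v)"
    by (metis inner_commute inner_transpose_mult)
  finally show False using assms by simp
qed

subsection \<open>Independent columns and rows\<close>

lemma subvec_nth: "subvec v J $ i = (if i \<in> J then v $ i else 0)"
  by (simp add: subvec_def)

lemma cols_mult: "cols A J *v v = A *v subvec v J"
  by (auto simp: vec_eq_iff cols_def subvec_def matrix_vector_mult_def intro!: sum.cong)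

lemma subvec_ident: "(\<And>i. i \<notin> J \<Longrightarrow> v $ i = 0) \<Longrightarrow> subvec v J = v"
  by (auto simp: vec_eq_iff subvec_def)

lemma transpose_cols_mult_nth:
  "(transpose (cols A J) *v w) $ i = (if i \<in> J then (transpose A *v w) $ i else 0)"
  by (simp add: matrix_vector_mult_def transpose_def cols_def)

text \<open>Coefficients are attached to indices rather than to vectors, so a repeated vector counts
  as a dependence.\<close>

lemma indep_family_iff:
  assumes "finite J"
  shows "indep_family v J \<longleftrightarrow> (\<forall>u. (\<Sum>j\<in>J. u j *\<^sub>R v j) = 0 \<longrightarrow> (\<forall>j\<in>J. u j = 0))"
proof
  assume L: "indep_family v J"
  show "\<forall>u. (\<Sum>j\<in>J. u j *\<^sub>R v j) = 0 \<longrightarrow> (\<forall>j\<in>J. u j = 0)"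
  proof (intro allI impI ballI)
    fix u j assume u: "(\<Sum>j\<in>J. u j *\<^sub>R v j) = 0" and j: "j \<in> J"
    have inj: "inj_on v J" and ind: "independent (v ` J)"
      using L by (auto simp: indep_family_def)
    have "(\<Sum>x\<in>v ` J. u (inv_into J v x) *\<^sub>R x) = 0"
      using u inj by (simp add: sum.reindex)
    then have "u (inv_into J v (v j)) = 0"
      using assms j
      by (intro real_vector.independentD[OF ind _ order_refl, where u = "\<lambda>x. u (inv_into J v x)"]) auto
    then show "u j = 0" using inj j by simp
  qed
next
  assume R: "\<forall>u. (\<Sum>j\<in>J. u j *\<^sub>R v j) = 0 \<longrightarrow> (\<forall>j\<in>J. u j = 0)"
  have inj: "inj_on v J"
  proof (rule inj_onI, rule ccontr)
    fix i j assume ij: "i \<in> J" "j \<in> J" "v i = v j" "i \<noteq> j"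
    \<comment> \<open>Coefficients 1 and -1 at two indices carrying the same vector form a
      nontrivial relation.\<close>
    define u :: "'a \<Rightarrow> real" where "u k = (if k = i then 1 else 0) - (if k = j then 1 else 0)" for k
    have "(\<Sum>k\<in>J. u k *\<^sub>R v k) = 0"
      using ij assms
      by (simp add: u_def scaleR_left_diff_distrib sum_subtractf if_distrib[of "\<lambda>r. r *\<^sub>R _"] cong: if_cong)
    with R ij have "u i = 0" by blast
    then show False using ij by (simp add: u_def)
  qed
  moreover have "independent (v ` J)"
  proof (rule real_vector.independent_if_scalars_zero)
    fix f x assume "(\<Sum>x\<in>v ` J. f x *\<^sub>R x) = 0" "x \<in> v ` J"
    with R inj show "f x = 0"
      by (auto simp: sum.reindex dest: spec[of _ "f \<circ> v"])
  qed (use assms in auto)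
  ultimately show "indep_family v J"
    by (simp add: indep_family_def)
qed

lemma matrix_mult_sum_scaleR:
  fixes A :: "real^'n^'m"
  shows "A *v x = (\<Sum>i\<in>UNIV. x $ i *\<^sub>R column i A)"
  by (simp add: matrix_mult_sum scalar_mult_eq_scaleR)

lemma cols_independent_iff:
  fixes A :: "real^'n^'m"
  shows "cols_independent A B \<longleftrightarrow> (\<forall>v. (\<forall>i. i \<notin> B \<longrightarrow> v $ i = 0) \<longrightarrow> A *v v = 0 \<longrightarrow> v = 0)"
proof -
  have sum: "(\<Sum>j\<in>B. v $ j *\<^sub>R column j A) = A *v v" if "\<forall>i. i \<notin> B \<longrightarrow> v $ i = 0" for v
    unfolding matrix_mult_sum_scaleR using that by (intro sum.mono_neutral_left) auto
  show ?thesis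
  proof
    assume "cols_independent A B"
    then show "\<forall>v. (\<forall>i. i \<notin> B \<longrightarrow> v $ i = 0) \<longrightarrow> A *v v = 0 \<longrightarrow> v = 0"
      unfolding cols_independent_def indep_family_iff[OF finite] using sum
      by (metis vec_eq_iff zero_index)
  next
    assume R: "\<forall>v. (\<forall>i. i \<notin> B \<longrightarrow> v $ i = 0) \<longrightarrow> A *v v = 0 \<longrightarrow> v = 0"
    show "cols_independent A B"
      unfolding cols_independent_def indep_family_iff[OF finite]
    proof (intro allI impI ballI)
      fix u j assume u: "(\<Sum>j\<in>B. u j *\<^sub>R column j A) = 0" and j: "j \<in> B"
      define v :: "real^'n" where "v = (\<chi> j. if j \<in> B then u j else 0)"
      have v: "\<forall>i. i \<notin> B \<longrightarrow> v $ i = 0" by (simp add: v_def)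
      have "A *v v = 0" using sum[OF v] u by (simp add: v_def)
      with R v have "v = 0" by blast
      then have "v $ j = 0" by simp
      then show "u j = 0" using j by (simp add: v_def)
    qed
  qed
qed

lemma rows_independent_iff:
  fixes A :: "real^'n^'m"
  shows "rows_independent A \<longleftrightarrow> (\<forall>w. transpose A *v w = 0 \<longrightarrow> w = 0)"
proof -
  have "rows_independent A \<longleftrightarrow> cols_independent (transpose A) UNIV"
    by (simp add: rows_independent_def cols_independent_def column_transpose)
  then show ?thesis by (simp add: cols_independent_iff)
qed

text \<open>The transpose has full column rank and is injective. Thus a nonzero dual direction
  changes the slack of some constraint.\<close>

lemma full_row_rank_kernel:
  fixes A :: "real^'n^'m"
  assumes "rank A = CARD('m)" and "transpose A *v w = 0"
  shows "w = 0"
proof -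
  have "rank (transpose A) = CARD('m)" using assms(1) by (simp add: rank_transpose)
  then have "inj ((*v) (transpose A))" by (simp only: full_rank_injective)
  then show ?thesis using assms(2) by (metis injD matrix_vector_mult_0_right)
qed

text \<open>Ensures that the truncated difference \<open>CARD('m) - card B\<close> is the true
  number of missing basis columns.\<close>

lemma card_cols_independent_le:
  fixes A :: "real^'n^'m"
  assumes "cols_independent A B"
  shows "card B \<le> CARD('m)"
proof -
  have "card B = card ((\<lambda>j. column j A) ` B)"
    using assms by (simp add: cols_independent_def indep_family_def card_image)
  also have "\<dots> \<le> DIM(real^'m)"
    using assms by (intro independent_card_le) (simp add: cols_independent_def indep_family_def)
  finally show ?thesis by simp
qed

text \<open>A maximal independent column set \<open>E\<close> between \<open>B\<close> and
  \<open>D\<close> spans all columns in \<open>D\<close>, and these span the whole space because the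
  rows of \<open>cols A D\<close> are independent. So \<open>E\<close> indexes a basis, and
  \<open>E - B\<close> is a valid choice.\<close>

lemma cols_independent_extend:
  fixes A :: "real^'n^'m"
  assumes B: "cols_independent A B" "B \<subseteq> D" and D: "rows_independent (cols A D)"
  obtains C where "C \<subseteq> D - B" "card C = CARD('m) - card B" "cols_independent A (B \<union> C)"
proof -
  define S where "S = {E. B \<subseteq> E \<and> E \<subseteq> D \<and> cols_independent A E}"
  have "finite S" by (rule finite)
  moreover have "B \<in> S" using B by (simp add: S_def)
  ultimately obtain E where "E \<in> S" and E_max: "\<forall>F\<in>S. E \<subseteq> F \<longrightarrow> E = F"
    using finite_has_maximal2[of S B] by blast
  then have E: "B \<subseteq> E" "E \<subseteq> D" "cols_independent A E"
    by (simp_all add: S_def)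
  let ?V = "span ((\<lambda>j. column j A) ` E)"
  have inD: "column j A \<in> ?V" if "j \<in> D" for j
  proof (rule ccontr)
    assume n: "column j A \<notin> ?V"
    then have "j \<notin> E" by (auto intro: span_base)
    have "cols_independent A (insert j E)"
      using E n span_base[of "column j A" "(\<lambda>j. column j A) ` E"]
      by (auto simp: cols_independent_def indep_family_def independent_insert inj_on_insert)
    then have "insert j E \<in> S" using E that by (auto simp: S_def)
    then have "E = insert j E" using E_max by blast
    then show False using \<open>j \<notin> E\<close> by blast
  qed
  have "?V = UNIV"
  proof (rule ccontr)
    assume "?V \<noteq> UNIV"
    then have "span ((\<lambda>j. column j A) ` E) \<subset> span UNIV" by auto
    then obtain w where w: "w \<noteq> 0" "\<And>z. z \<in> ?V \<Longrightarrow> orthogonal w z"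
      by (rule orthogonal_to_subspace_exists_gen) blast
    have "(transpose (cols A D) *v w) $ i = 0" for i
      unfolding transpose_cols_mult_nth
      using w(2)[OF inD, of i] by (simp add: transpose_mult_nth orthogonal_def inner_commute)
    then have "transpose (cols A D) *v w = 0" by (simp add: vec_eq_iff)
    then show False using D w(1) by (simp add: rows_independent_iff)
  qed
  have "card E = card ((\<lambda>j. column j A) ` E)"
    using E by (simp add: cols_independent_def indep_family_def card_image)
  also have "\<dots> = dim ?V"
    using E by (simp add: cols_independent_def indep_family_def dim_eq_card_independent)
  also have "\<dots> = CARD('m)"
    unfolding \<open>?V = UNIV\<close> by simp
  finally have card: "card E = CARD('m)" .
  show thesis
  proof
    show "E - B \<subseteq> D - B" using E by blast
    show "card (E - B) = CARD('m) - card B"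
      using E card by (subst card_Diff_subset) auto
    show "cols_independent A (B \<union> (E - B))"
      using E by (simp add: Un_absorb1)
  qed
qed

subsection \<open>The push phases\<close>

text \<open>\<open>\<theta>\<close> is the largest step keeping the coordinates in \<open>B\<close>
  nonnegative, and a minimising index reaches zero. The primal phase applies this to
  \<open>x\<close>, the dual phase to the slacks.\<close>

lemma ratio_test:
  fixes x d :: "'i::finite \<Rightarrow> real"
  assumes pos: "\<And>i. i \<in> B \<Longrightarrow> 0 < x i" and k: "k \<in> B" "d k < 0"
    and \<theta>: "\<theta> = Min {- x i / d i | i. i \<in> B \<and> d i < 0}"
  shows "\<And>i. i \<in> B \<Longrightarrow> 0 \<le> x i + \<theta> * d i" and "\<exists>i\<in>B. x i + \<theta> * d i = 0"
proof -
  let ?R = "{- x i / d i | i. i \<in> B \<and> d i < 0}"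
  have fin: "finite ?R" and "?R \<noteq> {}" using k by auto
  then have "\<theta> \<in> ?R" unfolding \<theta> by (rule Min_in)
  have le: "\<theta> \<le> r" if "r \<in> ?R" for r
    unfolding \<theta> using fin that by (rule Min_le)
  from \<open>\<theta> \<in> ?R\<close> obtain i where i: "i \<in> B" "d i < 0" "\<theta> = - x i / d i" by blast
  then have "x i + \<theta> * d i = 0" by simp
  then show "\<exists>i\<in>B. x i + \<theta> * d i = 0" using i by blast
  have "\<theta> \<ge> 0" using i pos[of i] by (simp add: divide_nonneg_neg zero_le_divide_iff)
  fix j assume j: "j \<in> B"
  show "0 \<le> x j + \<theta> * d j"
  proof (cases "d j < 0")
    case True
    then have "\<theta> \<le> - x j / d j" using j by (intro le) blast
    then show ?thesis using True by (simp add: field_simps)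
  next
    case False
    then show ?thesis using pos[OF j] \<open>\<theta> \<ge> 0\<close> by (simp add: add_nonneg_nonneg)
  qed
qed

section \<open>Invariant and termination of the primal push\<close>

text \<open>\<open>B0\<close> is the initial support. The bound on
  \<open>psteps s + card (pB s)\<close> is a budget: each step is paid for by an index leaving the
  support.\<close>

definition primal_inv ::
    "real^'n^'m \<Rightarrow> real^'m \<Rightarrow> 'n set \<Rightarrow> ('m::finite, 'n::finite) primal_state \<Rightarrow> bool" where
  "primal_inv A b B0 s \<longleftrightarrow>
     A *v px s = b \<and> (\<forall>i. 0 \<le> px s $ i) \<and> pB s = {i. 0 < px s $ i} \<and> pB s \<subseteq> B0 \<and>
     psteps s + card (pB s) \<le> card B0 \<and> length (pols s) = psteps s"

text \<open>Ranging over all dependent sets makes this a property of a single draw, whatever set the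
  run has reached.\<close>

definition generic_cost :: "real^'n^'m \<Rightarrow> real^'n \<Rightarrow> real^'n \<Rightarrow> bool" where
  "generic_cost A c \<delta> \<longleftrightarrow> (\<forall>B. \<not> cols_independent A B \<longrightarrow>
     ols_residual (transpose (cols A B), perturbed_cost c \<delta> B) \<noteq> 0)"

definition generic_rhs :: "real^'n^'m \<Rightarrow> real^'m \<Rightarrow> real^'m \<Rightarrow> bool" where
  "generic_rhs A b \<delta> \<longleftrightarrow> (\<forall>D. \<not> rows_independent (cols A D) \<longrightarrow>
     ols_residual (cols A D, perturbed_rhs b \<delta>) \<noteq> 0)"

lemma primal_residual:
  fixes A :: "real^'n^'m"
  assumes r: "r = ols_residual (transpose (cols A B), perturbed_cost c \<delta> B)"
  shows "\<And>i. i \<notin> B \<Longrightarrow> r $ i = 0" and "A *v r = 0"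
proof -
  show *: "r $ i = 0" if "i \<notin> B" for i
    using that by (simp add: r ols_residual_eq perturbed_cost_def subvec_nth transpose_cols_mult_nth)
  have "cols A B *v r = 0"
    unfolding r using transpose_mult_ols_residual[of "transpose (cols A B)"] by simp
  then show "A *v r = 0"
    using * by (simp add: cols_mult subvec_ident)
qed

text \<open>Genericity makes the direction nonzero, it lies in the kernel of \<open>A\<close>, and
  the sign choice gives it a negative entry in \<open>B\<close>, so the ratio test removes an
  index.\<close>

lemma primal_push_step_inv:
  fixes A :: "real^'n^'m" and s :: "('m, 'n) primal_state"
  assumes inv: "primal_inv A b B0 s" and dep: "\<not> cols_independent A (pB s)"
    and gen: "generic_cost A c (\<delta>c (psteps s))"
  shows "primal_inv A b B0 (primal_push_step A c \<delta>c s)"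
    and "card (pB (primal_push_step A c \<delta>c s)) < card (pB s)"
proof -
  define B where "B = pB s"
  define x where "x = px s"
  define P where "P = (transpose (cols A B), perturbed_cost c (\<delta>c (psteps s)) B)"
  define \<delta>0 where "\<delta>0 = - ols_residual P"
  define \<delta> where "\<delta> = (if \<forall>i\<in>B. 0 \<le> \<delta>0 $ i then - \<delta>0 else \<delta>0)"
  define \<theta> where "\<theta> = Min {- (x $ i) / (\<delta> $ i) | i. i \<in> B \<and> \<delta> $ i < 0}"
  define x' where "x' = x + \<theta> *\<^sub>R \<delta>"
  define B' where "B' = B - {i \<in> B. x' $ i = 0}"
  have nz: "\<delta>0 \<noteq> 0"
    using dep gen by (simp add: \<delta>0_def P_def B_def generic_cost_def)
  have step: "primal_push_step A c \<delta>c s =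
      \<lparr>psteps = Suc (psteps s), pols = pols s @ [P], pB = B', px = x'\<rparr>"
    using nz unfolding primal_push_step_def Let_def B_def[symmetric] x_def[symmetric]
      P_def[symmetric] \<delta>0_def[symmetric] \<delta>_def[symmetric] \<theta>_def[symmetric]
    by (simp add: x'_def B'_def)
  have I: "A *v x = b" "\<And>i. 0 \<le> x $ i" "B = {i. 0 < x $ i}" "B \<subseteq> B0"
    "psteps s + card B \<le> card B0" "length (pols s) = psteps s"
    using inv by (auto simp: primal_inv_def B_def x_def)
  have \<delta>0: "\<And>i. i \<notin> B \<Longrightarrow> \<delta>0 $ i = 0" "A *v \<delta>0 = 0"
    using primal_residual[of "ols_residual P" A B c "\<delta>c (psteps s)"]
    by (auto simp: \<delta>0_def P_def linear_neg[OF matrix_vector_mul_linear])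
  have \<delta>: "\<And>i. i \<notin> B \<Longrightarrow> \<delta> $ i = 0" "A *v \<delta> = 0"
    using \<delta>0 by (auto simp: \<delta>_def linear_neg[OF matrix_vector_mul_linear])
  \<comment> \<open>The direction vanishes outside \<open>B\<close>, so a nonzero entry lies in
    \<open>B\<close>; if no entry is negative, the flip makes this one negative.\<close>
  obtain k where k: "k \<in> B" "\<delta> $ k < 0"
  proof (cases "\<forall>i\<in>B. 0 \<le> \<delta>0 $ i")
    case True
    obtain k where "\<delta>0 $ k \<noteq> 0" using nz by (auto simp: vec_eq_iff)
    then have "k \<in> B" "\<delta> $ k < 0" using True \<delta>0(1)[of k] by (force simp: \<delta>_def)+
    then show thesis by (rule that)
  next
    case False
    then obtain k where "k \<in> B" "\<delta>0 $ k < 0" by (auto simp: not_le)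
    moreover have "\<delta> = \<delta>0" unfolding \<delta>_def using False by (rule if_not_P)
    ultimately show thesis by (intro that) simp_all
  qed
  have posB: "0 < x $ i" if "i \<in> B" for i using that I(3) by simp
  note ratio = ratio_test[of B "\<lambda>i. x $ i" k "\<lambda>i. \<delta> $ i" \<theta>, OF posB k \<theta>_def]
  have x'_out: "x' $ i = 0" if "i \<notin> B" for i
  proof -
    have "x $ i = 0" using that I(2)[of i] I(3) by simp
    then show ?thesis using \<delta>(1)[OF that] by (simp add: x'_def)
  qed
  have x'_nonneg: "0 \<le> x' $ i" for i
    using ratio(1)[of i] x'_out[of i] by (cases "i \<in> B") (auto simp: x'_def)
  have B': "B' = {i. 0 < x' $ i}"
    using x'_out x'_nonneg by (auto simp: B'_def less_le)
  have "B' \<subset> B" using ratio(2) by (auto simp: B'_def x'_def)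
  then have card: "card B' < card B" by (simp add: psubset_card_mono)
  then show "card (pB (primal_push_step A c \<delta>c s)) < card (pB s)"
    by (simp add: step B_def)
  have "A *v x' = b"
    using I(1) \<delta>(2) by (simp add: x'_def matrix_vector_right_distrib matrix_vector_mult_scaleR)
  then show "primal_inv A b B0 (primal_push_step A c \<delta>c s)"
    using x'_nonneg B' \<open>B' \<subset> B\<close> I(4-6) card by (auto simp: primal_inv_def step)
qed

lemma primal_push_terminates:
  fixes A :: "real^'n^'m"
  assumes x: "A *v x = b" "\<And>i. 0 \<le> x $ i" and gen: "\<And>k. generic_cost A c (\<delta>c k)"
  shows "\<exists>s. primal_push A c \<delta>c x = Some s \<and> cols_independent A (pB s) \<and>
    primal_inv A b {i. 0 < x $ i} s"
proof -
  let ?s = "\<lparr>psteps = 0, pols = [], pB = {i. 0 < x $ i}, px = x\<rparr> :: ('m, 'n) primal_state"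
  have init: "primal_inv A b {i. 0 < x $ i} ?s"
    using x by (simp add: primal_inv_def)
  have "\<exists>s. primal_push A c \<delta>c x = Some s"
    unfolding primal_push_def
    by (rule measure_while_option_Some[where P = "primal_inv A b {i. 0 < x $ i}" and f = "\<lambda>s. card (pB s)"])
      (use init gen primal_push_step_inv in blast)+
  then obtain s where s: "primal_push A c \<delta>c x = Some s" ..
  have "primal_inv A b {i. 0 < x $ i} s"
    by (rule while_option_rule[where P = "primal_inv A b {i. 0 < x $ i}", OF _ s[unfolded primal_push_def] init])
      (use gen primal_push_step_inv in blast)
  then show ?thesis
    using s while_option_stop[OF s[unfolded primal_push_def]] by blast
qed

section \<open>Invariant and termination of the dual push\<close>

definition dual_inv ::
    "real^'n^'m \<Rightarrow> real^'n \<Rightarrow> 'n set \<Rightarrow> ('m::finite, 'n::finite) dual_state \<Rightarrow> bool" where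
  "dual_inv A c N0 s \<longleftrightarrow>
     (\<forall>i. 0 \<le> slack A c (dy s) $ i) \<and> dD s = {i. slack A c (dy s) $ i = 0} \<and>
     dN s = {i. 0 < slack A c (dy s) $ i} \<and> dN s \<subseteq> N0 \<and>
     dsteps s + card (dN s) \<le> card N0 \<and> length (dols s) = dsteps s"

text \<open>The residual is nonzero by genericity and orthogonal to the active columns. Full row
  rank then provides an inactive column not orthogonal to it, so the step is never skipped and the
  ratio test activates a constraint.\<close>

lemma dual_push_step_inv:
  fixes A :: "real^'n^'m" and s :: "('m, 'n) dual_state"
  assumes rank: "rank A = CARD('m)"
    and inv: "dual_inv A c N0 s" and dep: "\<not> rows_independent (cols A (dD s))"
    and gen: "generic_rhs A b (\<delta>b (dsteps s))"
  shows "dual_inv A c N0 (dual_push_step A b c \<delta>b s)"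
    and "card (dN (dual_push_step A b c \<delta>b s)) < card (dN s)"
proof -
  define D where "D = dD s"
  define N where "N = dN s"
  define y where "y = dy s"
  define P where "P = (cols A D, perturbed_rhs b (\<delta>b (dsteps s)))"
  define \<delta>0 where "\<delta>0 = ols_residual P"
  define \<delta> where "\<delta> = (if \<forall>i\<in>N. (transpose A *v \<delta>0) $ i \<le> 0 then - \<delta>0 else \<delta>0)"
  define g where "g = transpose A *v \<delta>"
  define \<theta> where "\<theta> = Min {slack A c y $ i / g $ i | i. i \<in> N \<and> 0 < g $ i}"
  define y' where "y' = y + \<theta> *\<^sub>R \<delta>"
  define Z where "Z = {i \<in> N. slack A c y' $ i = 0}"
  have I: "\<And>i. 0 \<le> slack A c y $ i" "D = {i. slack A c y $ i = 0}"
    "N = {i. 0 < slack A c y $ i}" "N \<subseteq> N0"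
    "dsteps s + card N \<le> card N0" "length (dols s) = dsteps s"
    using inv by (auto simp: dual_inv_def D_def N_def y_def)
  have "\<delta>0 \<noteq> 0"
    using dep gen by (simp add: \<delta>0_def P_def D_def generic_rhs_def)
  then obtain k where k: "(transpose A *v \<delta>0) $ k \<noteq> 0"
    using full_row_rank_kernel[OF rank] by (fastforce simp: vec_eq_iff)
  have g0: "(transpose A *v \<delta>0) $ i = 0" if "i \<in> D" for i
  proof -
    have "(transpose (cols A D) *v \<delta>0) $ i = 0"
      by (simp add: \<delta>0_def P_def transpose_mult_ols_residual)
    then show ?thesis using that by (simp add: transpose_cols_mult_nth)
  qed
  have "k \<in> N" using k g0[of k] I(1)[of k] by (auto simp: I(2,3) less_le)
  then have nskip: "\<not> (\<forall>i\<in>N. (transpose A *v \<delta>0) $ i = 0)" using k by blast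
  have step: "dual_push_step A b c \<delta>b s =
      \<lparr>dsteps = Suc (dsteps s), dols = dols s @ [P], dD = D \<union> Z, dN = N - Z, dy = y'\<rparr>"
    unfolding dual_push_step_def Let_def D_def[symmetric] N_def[symmetric] y_def[symmetric]
      P_def[symmetric] \<delta>0_def[symmetric] \<delta>_def[symmetric] g_def[symmetric] \<theta>_def[symmetric]
      if_not_P[OF nskip]
    by (simp add: y'_def Z_def)
  have neg: "transpose A *v (- \<delta>0) = - (transpose A *v \<delta>0)"
    by (rule linear_neg) simp
  have gD: "g $ i = 0" if "i \<in> D" for i
    using g0[OF that] by (simp add: g_def \<delta>_def neg)
  obtain l where l: "l \<in> N" "- g $ l < 0"
  proof (cases "\<forall>i\<in>N. (transpose A *v \<delta>0) $ i \<le> 0")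
    case True
    then have "- g $ k < 0" using k \<open>k \<in> N\<close> by (auto simp: g_def \<delta>_def neg less_le)
    then show thesis using \<open>k \<in> N\<close> by (rule that[rotated])
  next
    case False
    then obtain l where "l \<in> N" "0 < (transpose A *v \<delta>0) $ l" by (auto simp: not_le)
    moreover have "\<delta> = \<delta>0" unfolding \<delta>_def using False by (rule if_not_P)
    ultimately show thesis by (intro that) (simp_all add: g_def)
  qed
  \<comment> \<open>Slacks move along \<open>- g\<close>, so this is a ratio test with direction
    \<open>- g\<close>; the double negation below casts \<open>\<theta>\<close> in its form.\<close>
  have slack': "slack A c y' $ i = slack A c y $ i + \<theta> * - g $ i" for i
    by (simp add: slack_nth y'_def g_def matrix_vector_right_distrib matrix_vector_mult_scaleR)
  have \<theta>: "\<theta> = Min {- (slack A c y $ i) / - g $ i | i. i \<in> N \<and> - g $ i < 0}"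
    by (simp add: \<theta>_def)
  have posN: "0 < slack A c y $ i" if "i \<in> N" for i using that I(3) by simp
  note ratio = ratio_test[of N "\<lambda>i. slack A c y $ i" l "\<lambda>i. - g $ i" \<theta>, OF posN l \<theta>]
  have slack'_D: "slack A c y' $ i = 0" if "i \<in> D" for i
    using that gD[OF that] I(2) by (simp add: slack')
  have DN: "i \<in> D \<or> i \<in> N" for i
    using I(1)[of i] by (auto simp: I(2,3) less_le)
  have slack'_nonneg: "0 \<le> slack A c y' $ i" for i
    using DN[of i] ratio(1)[of i] slack'_D[of i] by (auto simp: slack')
  have "Z \<noteq> {}" using ratio(2) by (auto simp: Z_def slack')
  then have "N - Z \<subset> N" by (auto simp: Z_def)
  then have card: "card (N - Z) < card N" by (simp add: psubset_card_mono)
  then show "card (dN (dual_push_step A b c \<delta>b s)) < card (dN s)"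
    by (simp add: step N_def)
  have "D \<union> Z = {i. slack A c y' $ i = 0}"
    using DN slack'_D by (auto simp: Z_def)
  moreover have "N - Z = {i. 0 < slack A c y' $ i}"
    using DN slack'_D slack'_nonneg by (fastforce simp: Z_def less_le)
  ultimately show "dual_inv A c N0 (dual_push_step A b c \<delta>b s)"
    using slack'_nonneg \<open>N - Z \<subset> N\<close> I(4-6) card by (auto simp: dual_inv_def step)
qed

lemma dual_push_terminates:
  fixes A :: "real^'n^'m"
  assumes rank: "rank A = CARD('m)"
    and y: "\<And>i. 0 \<le> slack A c y $ i" and gen: "\<And>k. generic_rhs A b (\<delta>b k)"
  shows "\<exists>t. dual_push A b c \<delta>b y = Some t \<and> rows_independent (cols A (dD t)) \<and>
    dual_inv A c {i. 0 < slack A c y $ i} t"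
proof -
  let ?N = "{i. 0 < slack A c y $ i}"
  let ?s = "\<lparr>dsteps = 0, dols = [], dD = {i. slack A c y $ i = 0}, dN = ?N, dy = y\<rparr>
    :: ('m, 'n) dual_state"
  have init: "dual_inv A c ?N ?s"
    using y by (simp add: dual_inv_def)
  have "\<exists>s. dual_push A b c \<delta>b y = Some s"
    unfolding dual_push_def
    by (rule measure_while_option_Some[where P = "dual_inv A c ?N" and f = "\<lambda>s. card (dN s)"])
      (use init gen dual_push_step_inv[OF rank] in blast)+
  then obtain s where s: "dual_push A b c \<delta>b y = Some s" ..
  have "dual_inv A c ?N s"
    by (rule while_option_rule[where P = "dual_inv A c ?N", OF _ s[unfolded dual_push_def] init])
      (use gen dual_push_step_inv[OF rank] in blast)
  then show ?thesis
    using s while_option_stop[OF s[unfolded dual_push_def]] by blast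
qed

subsection \<open>The crossover algorithm\<close>

lemma AE_generic_cost:
  fixes A :: "real^'n^'m" and \<delta>c :: "nat \<Rightarrow> 'w \<Rightarrow> real^'n" and \<delta>b :: "nat \<Rightarrow> 'w \<Rightarrow> real^'m"
  assumes "prob_space M" and draws: "independent_uniform_draws M \<delta>c \<delta>b"
  shows "AE \<omega> in M. generic_cost A c (\<delta>c k \<omega>)"
proof -
  have "AE \<omega> in M. \<forall>B\<in>{B. \<not> cols_independent A B}.
      ols_residual (transpose (cols A B), perturbed_cost c (\<delta>c k \<omega>) B) \<noteq> 0"
  proof (rule AE_finite_allI)
    fix B assume "B \<in> {B. \<not> cols_independent A B}"
    then obtain v where v: "\<And>i. i \<notin> B \<Longrightarrow> v $ i = 0" "A *v v = 0" "v \<noteq> 0"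
      by (auto simp: cols_independent_iff)
    define w where "w = (1 / (infnorm (subvec c B) + 1)) *\<^sub>R subvec c B"
    have "AE \<omega> in M. v \<bullet> (w + \<delta>c k \<omega>) \<noteq> 0"
      by (rule AE_inner_draw_neq_zero[where e = Inl])
        (use assms v(3) in \<open>auto simp: independent_uniform_draws_def\<close>)
    then show "AE \<omega> in M. ols_residual (transpose (cols A B), perturbed_cost c (\<delta>c k \<omega>) B) \<noteq> 0"
    proof eventually_elim
      case (elim \<omega>)
      \<comment> \<open>The witness \<open>v\<close> is supported on \<open>B\<close>, so
        restricting the draw to \<open>B\<close> does not affect the inner product.\<close>
      have "v \<bullet> subvec (\<delta>c k \<omega>) B = v \<bullet> \<delta>c k \<omega>"
        using v(1) by (auto simp: inner_vec_def subvec_nth intro!: sum.cong)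
      then have "v \<bullet> perturbed_cost c (\<delta>c k \<omega>) B \<noteq> 0"
        using elim by (simp add: perturbed_cost_def w_def inner_add_right)
      moreover have "cols A B *v v = 0"
        using v by (simp add: cols_mult subvec_ident)
      ultimately show ?case
        by (intro ols_residual_neq_zero[of _ v]) simp_all
    qed
  qed simp
  then show ?thesis by (simp add: generic_cost_def)
qed

lemma AE_generic_rhs:
  fixes A :: "real^'n^'m" and \<delta>c :: "nat \<Rightarrow> 'w \<Rightarrow> real^'n" and \<delta>b :: "nat \<Rightarrow> 'w \<Rightarrow> real^'m"
  assumes "prob_space M" and draws: "independent_uniform_draws M \<delta>c \<delta>b"
  shows "AE \<omega> in M. generic_rhs A b (\<delta>b k \<omega>)"
proof -
  have "AE \<omega> in M. \<forall>D\<in>{D. \<not> rows_independent (cols A D)}.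
      ols_residual (cols A D, perturbed_rhs b (\<delta>b k \<omega>)) \<noteq> 0"
  proof (rule AE_finite_allI)
    fix D assume "D \<in> {D. \<not> rows_independent (cols A D)}"
    then obtain v where v: "transpose (cols A D) *v v = 0" "v \<noteq> 0"
      by (auto simp: rows_independent_iff)
    have "AE \<omega> in M. v \<bullet> ((1 / (infnorm b + 1)) *\<^sub>R b + \<delta>b k \<omega>) \<noteq> 0"
      by (rule AE_inner_draw_neq_zero[where e = Inr])
        (use assms v(2) in \<open>auto simp: independent_uniform_draws_def\<close>)
    then show "AE \<omega> in M. ols_residual (cols A D, perturbed_rhs b (\<delta>b k \<omega>)) \<noteq> 0"
      by eventually_elim (simp add: perturbed_rhs_def ols_residual_neq_zero[OF v(1)])
  qed simp
  then show ?thesis by (simp add: generic_rhs_def)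
qed

section \<open>Correctness of the output and the step bound\<close>

text \<open>Independence of \<open>CARD('m)\<close> columns makes the basis matrix invertible.
  Feasibility with support in \<open>B\<close> and tightness on \<open>B\<close> become square
  systems, whose unique solutions are the required formulas.\<close>

lemma optimal_vertex_with_basisI:
  fixes A :: "real^'n^'m"
  assumes ind: "cols_independent A B" and card: "card B = CARD('m)"
    and x: "A *v x = b" "\<And>i. 0 \<le> x $ i" "\<And>i. i \<notin> B \<Longrightarrow> x $ i = 0"
    and y: "\<And>i. 0 \<le> slack A c y $ i" "\<And>i. i \<in> B \<Longrightarrow> slack A c y $ i = 0"
  shows "optimal_vertex_with_basis A b c x y B (UNIV - B)"
proof -
  obtain \<beta> :: "'m \<Rightarrow> 'n" where \<beta>: "bij_betw \<beta> UNIV B"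
    using finite_same_card_bij[of "UNIV :: 'm set" B] card by auto
  have inj: "inj \<beta>" and ran: "range \<beta> = B"
    using \<beta> by (auto simp: bij_betw_def)
  let ?M = "basis_matrix A \<beta>"
  have M: "?M *v (\<chi> j. v $ \<beta> j) = A *v v" if "\<And>i. i \<notin> B \<Longrightarrow> v $ i = 0" for v
  proof -
    have "(\<Sum>j\<in>UNIV. A $ i $ \<beta> j * v $ \<beta> j) = (\<Sum>j\<in>UNIV. A $ i $ j * v $ j)" for i
    proof -
      have "(\<Sum>j\<in>UNIV. A $ i $ \<beta> j * v $ \<beta> j) = (\<Sum>j\<in>B. A $ i $ j * v $ j)"
        using sum.reindex[OF inj, of "\<lambda>j. A $ i $ j * v $ j"] by (simp add: ran)
      also have "\<dots> = (\<Sum>j\<in>UNIV. A $ i $ j * v $ j)"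
        using that by (intro sum.mono_neutral_left) auto
      finally show ?thesis .
    qed
    then show ?thesis
      by (simp add: vec_eq_iff matrix_vector_mult_def basis_matrix_def)
  qed
  have "invertible ?M"
    unfolding invertible_left_inverse matrix_left_invertible_ker
  proof (intro allI impI)
    fix u assume u: "?M *v u = 0"
    \<comment> \<open>Spreads \<open>u\<close> over the coordinates in \<open>B\<close>, turning a
      kernel vector of the basis matrix into a linear relation among the columns of
      \<open>A\<close>.\<close>
    define v :: "real^'n" where "v = (\<chi> i. if i \<in> B then u $ inv \<beta> i else 0)"
    have "(\<chi> j. v $ \<beta> j) = u"
      using inj ran by (auto simp: v_def vec_eq_iff)
    moreover have v: "\<And>i. i \<notin> B \<Longrightarrow> v $ i = 0" by (simp add: v_def)
    ultimately have "A *v v = 0" using M[OF v] u by simp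
    then have "v = 0" using ind v by (simp add: cols_independent_iff)
    then show "u = 0" using \<open>(\<chi> j. v $ \<beta> j) = u\<close> by (auto simp: vec_eq_iff)
  qed
  then have invT: "invertible (transpose ?M)" by (rule transpose_invertible)
  have solve: "z = matrix_inv N *v d" if "invertible N" "N *v z = d" for N :: "real^'m^'m" and z d
  proof -
    have "matrix_inv N ** N = mat 1"
      using that(1) unfolding invertible_def matrix_inv_def by (rule someI2_ex) blast
    then show ?thesis
      by (simp add: matrix_vector_mul_assoc flip: that(2))
  qed
  have "(\<chi> j. x $ \<beta> j) = matrix_inv ?M *v b"
    using M[OF x(3)] x(1) by (intro solve[OF \<open>invertible ?M\<close>]) simp
  moreover have "y = matrix_inv (transpose ?M) *v (\<chi> j. c $ \<beta> j)"
  proof (rule solve[OF invT])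
    have "(transpose ?M *v y) $ j = (transpose A *v y) $ \<beta> j" for j
      by (simp add: matrix_vector_mult_def transpose_def basis_matrix_def)
    moreover have "\<beta> j \<in> B" for j using ran by blast
    ultimately show "transpose ?M *v y = (\<chi> j. c $ \<beta> j)"
      using y(2) by (simp add: vec_eq_iff slack_nth)
  qed
  ultimately show ?thesis
    unfolding optimal_vertex_with_basis_def
    using \<beta> \<open>invertible ?M\<close> card x(2,3) y(1) by (auto simp: slack_nth)
qed

lemma crossover_correct:
  fixes A :: "real^'n^'m"
  assumes rank: "rank A = CARD('m)" and opt: "primal_dual_optimal A b c x y"
    and gen: "\<And>k. generic_cost A c (\<delta>c k)" "\<And>k. generic_rhs A b (\<delta>b k)"
  shows "\<exists>k q x' y' B N. crossover A b c \<delta>c \<delta>b x y k q x' y' B N"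
    and "crossover A b c \<delta>c \<delta>b x y k q x' y' B N \<Longrightarrow>
      optimal_vertex_with_basis A b c x' y' B N \<and> k \<le> CARD('n) \<and> q \<le> CARD('n)"
proof -
  let ?B0 = "{i. 0 < x $ i}" and ?N0 = "{i. 0 < slack A c y $ i}"
  have x: "A *v x = b" "\<And>i. 0 \<le> x $ i" and y: "\<And>i. 0 \<le> slack A c y $ i"
    using opt dual_feasible_iff_slack[of A c y]
    by (auto simp: primal_dual_optimal_def primal_optimal_def primal_feasible_def dual_optimal_def)
  obtain s where s: "primal_push A c \<delta>c x = Some s" "cols_independent A (pB s)"
    "primal_inv A b ?B0 s"
    using primal_push_terminates[where \<delta>c = \<delta>c, OF x gen(1)] by blast
  obtain t where t: "dual_push A b c \<delta>b y = Some t" "rows_independent (cols A (dD t))"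
    "dual_inv A c ?N0 t"
    using dual_push_terminates[where \<delta>b = \<delta>b, OF rank y gen(2)] by blast
  have disj: "?B0 \<inter> ?N0 = {}"
    using complementary_slackness[OF opt] by fastforce
  have "i \<in> dD t" if "i \<in> pB s" for i
  proof -
    \<comment> \<open>Both sets only shrink during the pushes, so the initial disjointness persists
      and the final support is active.\<close>
    have "pB s \<subseteq> ?B0" using s(3) unfolding primal_inv_def by blast
    moreover have "dN t \<subseteq> ?N0" using t(3) unfolding dual_inv_def by blast
    ultimately have "i \<notin> dN t" using that disj by blast
    then show ?thesis using t(3) by (auto simp: dual_inv_def less_le)
  qed
  then have "pB s \<subseteq> dD t" by blast
  with s(2) t(2) obtain C where "C \<subseteq> dD t - pB s" "card C = CARD('m) - card (pB s)"
    "cols_independent A (pB s \<union> C)"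
    using cols_independent_extend by metis
  then show "\<exists>k q x' y' B N. crossover A b c \<delta>c \<delta>b x y k q x' y' B N"
    using s(1) t(1) unfolding crossover_def by blast
  assume "crossover A b c \<delta>c \<delta>b x y k q x' y' B N"
  then obtain C where C: "C \<subseteq> dD t - pB s" "card C = CARD('m) - card (pB s)"
    "cols_independent A (pB s \<union> C)"
    and out: "x' = px s" "y' = dy t" "B = pB s \<union> C" "N = UNIV - B"
      "k = psteps s + dsteps t" "q = length (pols s) + length (dols t)"
    unfolding crossover_def using s(1) t(1) by auto
  have "card B = card (pB s) + card C"
    unfolding out(3) using C(1) by (intro card_Un_disjoint) auto
  then have card: "card B = CARD('m)"
    using C(2) card_cols_independent_le[OF s(2)] by simp
  have "optimal_vertex_with_basis A b c x' y' B N"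
    unfolding out(4)
  proof (rule optimal_vertex_with_basisI)
    show "cols_independent A B" using C(3) out(3) by simp
    show "A *v x' = b" "\<And>i. 0 \<le> x' $ i"
      using s(3) by (auto simp: primal_inv_def out)
    show "x' $ i = 0" if "i \<notin> B" for i
      using that s(3) by (auto simp: primal_inv_def out less_le)
    show "\<And>i. 0 \<le> slack A c y' $ i"
      using t(3) by (auto simp: dual_inv_def out)
    show "slack A c y' $ i = 0" if "i \<in> B" for i
      using that t(3) C(1) \<open>pB s \<subseteq> dD t\<close> by (auto simp: dual_inv_def out)
  qed (rule card)
  \<comment> \<open>The two budgets are the sizes of disjoint index sets, so together they are at
    most \<open>CARD('n)\<close>.\<close>
  moreover have "psteps s + dsteps t \<le> card ?B0 + card ?N0"
    using s(3) t(3) by (auto simp: primal_inv_def dual_inv_def)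
  moreover have "card ?B0 + card ?N0 = card (?B0 \<union> ?N0)"
    using disj by (intro card_Un_disjoint[symmetric]) auto
  moreover have "card (?B0 \<union> ?N0) \<le> CARD('n)"
    by (intro card_mono) auto
  moreover have "k = psteps s + dsteps t" "q = psteps s + dsteps t"
    using s(3) t(3) by (auto simp: primal_inv_def dual_inv_def out)
  ultimately show "optimal_vertex_with_basis A b c x' y' B N \<and> k \<le> CARD('n) \<and> q \<le> CARD('n)"
    by linarith
qed

text \<open>Since \<open>crossover\<close> is a relation, termination is the existence of a run,
  while correctness and the bounds concern every admissible selection.\<close>

theorem theorem11:
  fixes A :: "real^'n^'m" and b :: "real^'m" and c :: "real^'n"
    and x :: "real^'n" and y :: "real^'m"
    and M :: "'w measure"
    and \<delta>c :: "nat \<Rightarrow> 'w \<Rightarrow> real^'n" and \<delta>b :: "nat \<Rightarrow> 'w \<Rightarrow> real^'m"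
  assumes "rank A = CARD('m)"
    and "primal_dual_optimal A b c x y"
    and "prob_space M"
    and "independent_uniform_draws M \<delta>c \<delta>b"
  shows "AE \<omega> in M.
    (\<exists>k q x' y' B N.
       crossover A b c (\<lambda>k. \<delta>c k \<omega>) (\<lambda>k. \<delta>b k \<omega>) x y k q x' y' B N) \<and>
    (\<forall>k q x' y' B N.
       crossover A b c (\<lambda>k. \<delta>c k \<omega>) (\<lambda>k. \<delta>b k \<omega>) x y k q x' y' B N \<longrightarrow>
         optimal_vertex_with_basis A b c x' y' B N \<and> k \<le> CARD('n) \<and> q \<le> CARD('n))"
proof -
  have "AE \<omega> in M. \<forall>k. generic_cost A c (\<delta>c k \<omega>)"
    using AE_generic_cost[OF assms(3,4)] by (simp add: AE_all_countable)
  moreover have "AE \<omega> in M. \<forall>k. generic_rhs A b (\<delta>b k \<omega>)"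
    using AE_generic_rhs[OF assms(3,4)] by (simp add: AE_all_countable)
  ultimately show ?thesis
  proof eventually_elim
    case (elim \<omega>)
    then have "generic_cost A c (\<delta>c k \<omega>)" "generic_rhs A b (\<delta>b k \<omega>)" for k
      by blast+
    note * = crossover_correct[where \<delta>c = "\<lambda>k. \<delta>c k \<omega>" and \<delta>b = "\<lambda>k. \<delta>b k \<omega>",
        OF assms(1,2) this]
    show ?case
      using *(1) by (intro conjI allI impI *(2))
  qed
qed

end
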